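(* For every integer $k\ge 1$, the graph $H(k)$ satisfies $\gamma_{1,2}(H(k))>c_{\mathrm{ind}}(H(k))$ although $H(k)$ is not a trilobite (i.e. it is not isomorphic to any trilobite). Consequently the following conjecture is false: (I) "for a connected cubic graph $G$ we have $\gamma_{1,2}(G)>c_{\mathrm{ind}}(G)$ if and only if $G$ is a trilobite". Moreover, with $n=4k+16$ the order of $H(k)$, $c_{\mathrm{ind}}(H(k))=n/2+2$ and $\gamma_{1,2}(H(k))=n/2+3>c_{\mathrm{ind}}(H(k))$, so the following conjecture is false as well: (II) "if a cubic graph $G$ of order $n$ satisfies $c_{\mathrm{ind}}(G)\ge n/2+2$, then $\gamma_{1,2}(G)\le c_{\mathrm{ind}}(G)$". Both conjectures (I) and (II) fail for infinitely many orders $n\equiv 0\pmod 4$, $n\ge 20$ (that is, for infinitely many such $n$ there is a graph of order $n$ violating (I) and a graph of order $n$ violating (II)).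
   Context: All graphs are finite and simple; a graph is cubic if every vertex has degree $3$. A set $S\subseteq V(G)$ is a $(1,2)$-dominating set of $G$ if every vertex outside $S$ has at least one neighbour in $S$ and every vertex of $S$ has at least two neighbours in $S$; $\gamma_{1,2}(G)$ is the smallest size of a $(1,2)$-dominating set. The induced cycles vertex number $c_{\mathrm{ind}}(G)$ is the largest size of a set $S\subseteq V(G)$ inducing a $2$-regular subgraph. Trilobites: a trilobite is a cubic graph of order $n\ge 10$ consisting of three vertex-disjoint paths (strands) $x^j_1x^j_2\cdots x^j_p$ ($1\le j\le 3$) with the same number $p\ge 2$ of vertices, such that: at each of the two end positions $i\in\{1,p\}$ the strands are joined either by a triangle (the three vertices $x^1_i,x^2_i,x^3_i$ are pairwise adjacent) or by a $K_{2,3}$ (two new vertices, each adjacent to exactly $x^1_i,x^2_i,x^3_i$); and at each interior position $1<i<p$ there is a claw centre, a new vertex adjacent to exactly $x^1_i,x^2_i,x^3_i$. There are no other vertices or edges. For an integer $k\ge 1$, the graph $H(k)$ has the $16+4k$ distinct vertices $a_1,a_2$; $u^j_i$ ($1\le j\le 3$, $0\le i\le k+1$; $j$ is a superscript index); $m_i$ ($1\le i\le k$); $v_1,v_2,v_3$; $z_1,z_2,z_3$; $b_1,b_2$. Its edges are: $a_1u^j_0$ and $a_2u^j_0$ for $1\le j\le 3$; $u^j_{i-1}u^j_i$ for $1\le j\le 3$ and $1\le i\le k+1$; $m_iu^j_i$ for $1\le j\le 3$ and $1\le i\le k$; the triangle edges $u^1_{k+1}u^2_{k+1}$, $u^1_{k+1}v_1$,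 $u^2_{k+1}v_1$; the triangle edges $u^3_{k+1}v_2$, $u^3_{k+1}v_3$, $v_2v_3$; $v_jz_j$ for $1\le j\le 3$; $b_1z_j$ and $b_2z_j$ for $1\le j\le 3$. *)

theory Defs
  imports Complex_Main "Graph_Theory.Graph_Theory"
begin

text \<open>
  A finite simple graph is a \<^const>\<open>pair_graph\<close>: a finite vertex set with a symmetric,
  irreflexive arc set. Each undirected edge is present as two opposite arcs, so the degree of a
  vertex is its out-degree.
\<close>

definition regular :: "nat \<Rightarrow> ('a, 'b) pre_digraph \<Rightarrow> bool" where
  "regular d G \<longleftrightarrow> (\<forall>v \<in> verts G. out_degree G v = d)"

definition cubic_graph :: "'a pair_pre_digraph \<Rightarrow> bool" where
  "cubic_graph G \<longleftrightarrow> pair_graph G \<and> regular 3 G"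

abbreviation order :: "'a pair_pre_digraph \<Rightarrow> nat" where
  "order G \<equiv> card (pverts G)"

definition dominating12 :: "'a pair_pre_digraph \<Rightarrow> 'a set \<Rightarrow> bool" where
  "dominating12 G S \<longleftrightarrow>
     S \<subseteq> pverts G \<and>
     (\<forall>v \<in> pverts G - S. \<exists>u \<in> S. v \<rightarrow>\<^bsub>G\<^esub> u) \<and>
     (\<forall>v \<in> S. card {u \<in> S. v \<rightarrow>\<^bsub>G\<^esub> u} \<ge> 2)"

text \<open>
  In a cubic graph the whole vertex set is a (1,2)-dominating set, so the minimum below is taken
  over a nonempty set. The maximum is always over a nonempty set, because the empty set
  qualifies.
\<close>

definition gamma12 :: "'a pair_pre_digraph \<Rightarrow> nat" where
  "gamma12 G = Min {card S | S. dominating12 G S}"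

definition c_ind :: "'a pair_pre_digraph \<Rightarrow> nat" where
  "c_ind G = Max {card S | S. S \<subseteq> pverts G \<and> regular 2 (G \<restriction> S)}"

definition undirected :: "'a set \<Rightarrow> 'a rel \<Rightarrow> 'a pair_pre_digraph" where
  "undirected V E = \<lparr> pverts = V, parcs = E \<union> E\<inverse> \<rparr>"


datatype end_type = Triangle | K23

text \<open>
  \<open>Strand j i\<close> is the \<open>i\<close>-th vertex of the \<open>j\<close>-th strand and \<open>Claw i\<close> the claw centre at the
  interior position \<open>i\<close>. \<open>Cap i h\<close> with \<open>h\<close> = 1, 2 are the two additional vertices at the end
  position \<open>i\<close>; they are used only if that end is a \<open>K\<^sub>2\<^sub>,\<^sub>3\<close>.
\<close>

datatype tri_vertex = Strand nat nat | Claw nat | Cap nat nat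

fun end_verts :: "end_type \<Rightarrow> nat \<Rightarrow> tri_vertex set" where
  "end_verts Triangle i = {}"
| "end_verts K23 i = {Cap i 1, Cap i 2}"

fun end_edges :: "end_type \<Rightarrow> nat \<Rightarrow> tri_vertex rel" where
  "end_edges Triangle i =
     {(Strand 1 i, Strand 2 i), (Strand 1 i, Strand 3 i), (Strand 2 i, Strand 3 i)}"
| "end_edges K23 i = {(Cap i h, Strand j i) | h j. h \<in> {1, 2} \<and> j \<in> {1..3}}"

definition trilobite_graph :: "nat \<Rightarrow> end_type \<Rightarrow> end_type \<Rightarrow> tri_vertex pair_pre_digraph" where
  "trilobite_graph p s t = undirected
     ({Strand j i | j i. j \<in> {1..3} \<and> i \<in> {1..p}} \<union>
      {Claw i | i. 1 < i \<and> i < p} \<union>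
      end_verts s 1 \<union> end_verts t p)
     ({(Strand j i, Strand j (i + 1)) | j i. j \<in> {1..3} \<and> 1 \<le> i \<and> i < p} \<union>
      {(Claw i, Strand j i) | j i. j \<in> {1..3} \<and> 1 < i \<and> i < p} \<union>
      end_edges s 1 \<union> end_edges t p)"

definition trilobite :: "'a pair_pre_digraph \<Rightarrow> bool" where
  "trilobite G \<longleftrightarrow>
     cubic_graph G \<and> order G \<ge> 10 \<and>
     (\<exists>p s t. p \<ge> 2 \<and> digraph_iso (trilobite_graph p s t) G)"


text \<open>\<open>U j i\<close> is \<open>u\<close> with superscript \<open>j\<close> and subscript \<open>i\<close>.\<close>

datatype H_vertex = A nat | U nat nat | M nat | V nat | Z nat | B nat

definition H :: "nat \<Rightarrow> H_vertex pair_pre_digraph" where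
  "H k = undirected
     ({A 1, A 2} \<union>
      {U j i | j i. j \<in> {1..3} \<and> i \<in> {0..k + 1}} \<union>
      {M i | i. i \<in> {1..k}} \<union>
      {V 1, V 2, V 3} \<union> {Z 1, Z 2, Z 3} \<union> {B 1, B 2})
     ({(A h, U j 0) | h j. h \<in> {1, 2} \<and> j \<in> {1..3}} \<union>
      {(U j (i - 1), U j i) | j i. j \<in> {1..3} \<and> i \<in> {1..k + 1}} \<union>
      {(M i, U j i) | j i. j \<in> {1..3} \<and> i \<in> {1..k}} \<union>
      {(U 1 (k + 1), U 2 (k + 1)), (U 1 (k + 1), V 1), (U 2 (k + 1), V 1)} \<union>
      {(U 3 (k + 1), V 2), (U 3 (k + 1), V 3), (V 2, V 3)} \<union>
      {(V j, Z j) | j. j \<in> {1..3}} \<union>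
      {(B h, Z j) | h j. h \<in> {1, 2} \<and> j \<in> {1..3}})"


text \<open>
  The two conjectures as properties of a single graph; a graph violates a conjecture if it fails
  the property. The conjectures themselves quantify over all graphs with vertices in
  \<^typ>\<open>nat\<close>, which up to isomorphism are all finite graphs.
\<close>

definition conjecture_I_for :: "'a pair_pre_digraph \<Rightarrow> bool" where
  "conjecture_I_for G \<longleftrightarrow>
     (cubic_graph G \<and> connected G \<longrightarrow> (gamma12 G > c_ind G \<longleftrightarrow> trilobite G))"

definition conjecture_II_for :: "'a pair_pre_digraph \<Rightarrow> bool" where
  "conjecture_II_for G \<longleftrightarrow>
     (cubic_graph G \<and> real (c_ind G) \<ge> real (order G) / 2 + 2 \<longrightarrow> gamma12 G \<le> c_ind G)"

definition conjecture_I :: bool where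
  "conjecture_I \<longleftrightarrow> (\<forall>G :: nat pair_pre_digraph. conjecture_I_for G)"

definition conjecture_II :: bool where
  "conjecture_II \<longleftrightarrow> (\<forall>G :: nat pair_pre_digraph. conjecture_II_for G)"

end

theory Submission
  imports Defs
begin

text \<open>
  For a set \<open>S\<close> of vertices of a cubic graph let the excess of a vertex be the number of
  its neighbours in \<open>S\<close>, minus 1, and minus another 1 if the vertex is itself in \<open>S\<close>.
  Double counting shows that the excesses add up to \<open>2 |S| - n\<close> (lemma \<open>sum_excess\<close>). A
  set is (1,2)-dominating if and only if all excesses are nonnegative, and it induces a
  2-regular subgraph if and only if the excess vanishes on the set. So both parameters
  of \<open>H k\<close> are determined by the extreme values of the total excess: the claim is that
  it is at least 6 for dominating sets and at most 4 for induced cycles.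

  \<open>H k\<close> is a long ladder of three strands, closed by a \<open>K\<^sub>2\<^sub>,\<^sub>3\<close> at the left and by two
  triangles followed by a \<open>K\<^sub>2\<^sub>,\<^sub>3\<close> at the right. The total excess of the first layers
  depends on the rest of the graph only through the memberships in \<open>S\<close> of the last of
  these layers and of the next one. Bounds in terms of these six memberships are found
  that are preserved when a layer is appended (lemmas \<open>arm_bound_step\<close> and
  \<open>cycle_bound_step\<close>); one layer is a finite check, and induction gives all lengths. The
  triangles and the right end are a last finite check (\<open>gadget_bound\<close> and
  \<open>gadget_cycles\<close>). For dominating sets the check gives 5, which parity improves to 6.

  Both bounds are attained: by a cycle along two of the strands, and by a path that
  moves around the three strands with period six. The path is laid out from the right,
  so that only the parity of \<open>k\<close> matters at the left end.

  Finally \<open>H k\<close> is not a trilobite because it has two disjoint triangles and its order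
  is divisible by 4 (\<open>H_not_trilobite\<close>). All notions involved are invariant under
  isomorphism, so copies of the graphs \<open>H k\<close> on the natural numbers refute both
  conjectures.
\<close>

section \<open>The excess of a vertex\<close>

definition excess :: "'a pair_pre_digraph \<Rightarrow> 'a set \<Rightarrow> 'a \<Rightarrow> int" where
  "excess G S v = int (card {u \<in> S. v \<rightarrow>\<^bsub>G\<^esub> u}) - 1 - of_bool (v \<in> S)"

lemma cubic_graphD:
  assumes "cubic_graph G"
  shows "finite (pverts G)"
    and "v \<rightarrow>\<^bsub>G\<^esub> u \<Longrightarrow> u \<rightarrow>\<^bsub>G\<^esub> v"
    and "v \<in> pverts G \<Longrightarrow> card {u \<in> pverts G. v \<rightarrow>\<^bsub>G\<^esub> u} = 3"
proof -
  interpret pair_graph G using assms by (simp add: cubic_graph_def)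
  show "finite (pverts G)" by simp
  show "v \<rightarrow>\<^bsub>G\<^esub> u \<Longrightarrow> u \<rightarrow>\<^bsub>G\<^esub> v" by (simp add: arcs_symmetric)
  assume v: "v \<in> pverts G"
  have "out_arcs G v = Pair v ` {u \<in> pverts G. v \<rightarrow>\<^bsub>G\<^esub> u}"
    by (auto simp: out_arcs_def dest: in_arcsD2)
  then have "out_degree G v = card {u \<in> pverts G. v \<rightarrow>\<^bsub>G\<^esub> u}"
    by (simp add: out_degree_def card_image inj_on_def)
  with v assms show "card {u \<in> pverts G. v \<rightarrow>\<^bsub>G\<^esub> u} = 3"
    by (simp add: cubic_graph_def regular_def)
qed

text \<open>
  Counting the pairs of a vertex and a neighbour of it in \<open>S\<close> from the side of the
  neighbour gives \<open>3 |S|\<close>. The sum therefore measures by how much \<open>S\<close> differs from half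
  of the vertices.
\<close>

lemma sum_excess:
  assumes "cubic_graph G" and S: "S \<subseteq> pverts G"
  shows "(\<Sum>v\<in>pverts G. excess G S v) = 2 * int (card S) - int (order G)"
proof -
  note G = cubic_graphD[OF assms(1)]
  have fin: "finite S" using G(1) S finite_subset by blast
  have "(\<Sum>v\<in>pverts G. int (card {u \<in> S. v \<rightarrow>\<^bsub>G\<^esub> u}))
      = (\<Sum>v\<in>pverts G. \<Sum>u\<in>S. of_bool (v \<rightarrow>\<^bsub>G\<^esub> u))"
    using fin by (simp add: Int_def)
  also have "\<dots> = (\<Sum>u\<in>S. \<Sum>v\<in>pverts G. of_bool (v \<rightarrow>\<^bsub>G\<^esub> u))"
    by (rule sum.swap)
  also have "\<dots> = (\<Sum>u\<in>S. int (card {v \<in> pverts G. u \<rightarrow>\<^bsub>G\<^esub> v}))"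
  proof (rule sum.cong[OF refl])
    fix u
    have "{v \<in> pverts G. v \<rightarrow>\<^bsub>G\<^esub> u} = {v \<in> pverts G. u \<rightarrow>\<^bsub>G\<^esub> v}" using G(2) by blast
    then show "(\<Sum>v\<in>pverts G. of_bool (v \<rightarrow>\<^bsub>G\<^esub> u)) = int (card {v \<in> pverts G. u \<rightarrow>\<^bsub>G\<^esub> v})"
      using G(1) by (simp add: Int_def)
  qed
  also have "\<dots> = 3 * int (card S)"
    using G(3) S by (simp add: subset_iff)
  finally have "(\<Sum>v\<in>pverts G. int (card {u \<in> S. v \<rightarrow>\<^bsub>G\<^esub> u})) = 3 * int (card S)" .
  moreover have "(\<Sum>v\<in>pverts G. of_bool (v \<in> S)) = int (card S)"
    using G(1) S by (simp add: Int_absorb1)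
  ultimately show ?thesis
    unfolding excess_def by (simp add: sum_subtractf)
qed

lemma dominating12_iff_excess:
  assumes "cubic_graph G"
  shows "dominating12 G S \<longleftrightarrow> S \<subseteq> pverts G \<and> (\<forall>v\<in>pverts G. 0 \<le> excess G S v)"
proof (cases "S \<subseteq> pverts G")
  case True
  then have "finite S" using cubic_graphD(1)[OF assms] finite_subset by blast
  then have "(\<exists>u\<in>S. v \<rightarrow>\<^bsub>G\<^esub> u) \<longleftrightarrow> 1 \<le> card {u \<in> S. v \<rightarrow>\<^bsub>G\<^esub> u}" for v
    by (auto simp: Suc_le_eq card_gt_0_iff)
  then have "dominating12 G S \<longleftrightarrow> (\<forall>v\<in>pverts G. (if v \<in> S then 2 else 1) \<le> card {u \<in> S. v \<rightarrow>\<^bsub>G\<^esub> u})"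
    using True unfolding dominating12_def by auto
  also have "\<dots> \<longleftrightarrow> (\<forall>v\<in>pverts G. 0 \<le> excess G S v)"
    unfolding excess_def by (intro ball_cong) auto
  finally show ?thesis using True by simp
qed (simp add: dominating12_def)

lemma regular2_induced_iff_excess:
  fixes G :: "'a pair_pre_digraph"
  shows "regular 2 (G \<restriction> S) \<longleftrightarrow> (\<forall>v\<in>S. excess G S v = 0)"
proof -
  have "out_degree (G \<restriction> S) v = card {u \<in> S. v \<rightarrow>\<^bsub>G\<^esub> u}" if "v \<in> S" for v
  proof -
    have "out_arcs (G \<restriction> S) v = Pair v ` {u \<in> S. v \<rightarrow>\<^bsub>G\<^esub> u}"
      using that by (auto simp: out_arcs_def)
    then show ?thesis by (simp add: out_degree_def card_image inj_on_def)
  qed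
  then show ?thesis unfolding regular_def excess_def by auto
qed

lemma gamma12_eqI:
  assumes "finite (pverts G)" "dominating12 G S" "card S = m"
    and "\<And>T. dominating12 G T \<Longrightarrow> m \<le> card T"
  shows "gamma12 G = m"
  unfolding gamma12_def
proof (rule Min_eqI)
  show "finite {card S | S. dominating12 G S}"
    by (rule finite_subset[of _ "card ` Pow (pverts G)"]) (auto simp: dominating12_def assms(1))
qed (use assms in auto)

lemma c_ind_eqI:
  fixes G :: "'a pair_pre_digraph"
  assumes "finite (pverts G)" "S \<subseteq> pverts G" "regular 2 (G \<restriction> S)" "card S = m"
    and "\<And>T. T \<subseteq> pverts G \<Longrightarrow> regular 2 (G \<restriction> T) \<Longrightarrow> card T \<le> m"
  shows "c_ind G = m"
  unfolding c_ind_def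
proof (rule Max_eqI)
  show "finite {card S | S. S \<subseteq> pverts G \<and> regular 2 (G \<restriction> S)}"
    by (rule finite_subset[of _ "card ` Pow (pverts G)"]) (auto simp: assms(1))
qed (use assms in auto)


section \<open>The structure of \<open>H k\<close>\<close>

text \<open>
  The three neighbours of each vertex. In the equation for \<open>U\<close> the last branches are the
  layer \<open>k + 1\<close>; in the equation for \<open>V\<close> the term \<open>5 - j\<close> exchanges 2 and 3.
\<close>

fun nbrs :: "nat \<Rightarrow> H_vertex \<Rightarrow> H_vertex list" where
  "nbrs k (A h) = [U 1 0, U 2 0, U 3 0]"
| "nbrs k (U j i) =
    (if i = 0 then [A 1, A 2, U j 1]
     else if i \<le> k then [M i, U j (i - 1), U j (i + 1)]
     else if j = 1 then [U 1 k, U 2 (k + 1), V 1]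
     else if j = 2 then [U 2 k, U 1 (k + 1), V 1]
     else [U 3 k, V 2, V 3])"
| "nbrs k (M i) = [U 1 i, U 2 i, U 3 i]"
| "nbrs k (V j) =
    (if j = 1 then [Z 1, U 1 (k + 1), U 2 (k + 1)]
     else [Z j, U 3 (k + 1), V (5 - j)])"
| "nbrs k (Z j) = [V j, B 1, B 2]"
| "nbrs k (B h) = [Z 1, Z 2, Z 3]"

lemma strand_indices: "{1..3} = {1, 2, 3 :: nat}"
  by auto

lemma H_verts:
  "pverts (H k) = A ` {1, 2} \<union> (\<Union>j\<in>{1, 2, 3}. U j ` {..k + 1}) \<union> M ` {1..k}
     \<union> V ` {1, 2, 3} \<union> Z ` {1, 2, 3} \<union> B ` {1, 2}"
  unfolding H_def undirected_def strand_indices by auto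


lemma in_H_verts [simp]:
  "A h \<in> pverts (H k) \<longleftrightarrow> h \<in> {1, 2}"
  "U j i \<in> pverts (H k) \<longleftrightarrow> j \<in> {1, 2, 3} \<and> i \<le> k + 1"
  "M i \<in> pverts (H k) \<longleftrightarrow> i \<in> {1..k}"
  "V j \<in> pverts (H k) \<longleftrightarrow> j \<in> {1, 2, 3}"
  "Z j \<in> pverts (H k) \<longleftrightarrow> j \<in> {1, 2, 3}"
  "B h \<in> pverts (H k) \<longleftrightarrow> h \<in> {1, 2}"
  by (auto simp: H_verts)

text \<open>
  The edges of \<open>H k\<close>, each in one orientation, decided by the shape of the two end
  vertices. Membership in the comprehensions of the definition is thereby computed by
  rewriting.
\<close>

fun H_edge :: "nat \<Rightarrow> H_vertex \<Rightarrow> H_vertex \<Rightarrow> bool" where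
  "H_edge k (A h) (U j i) \<longleftrightarrow> h \<in> {1, 2} \<and> j \<in> {1, 2, 3} \<and> i = 0"
| "H_edge k (U j i) (U j' i') \<longleftrightarrow>
     j = j' \<and> j \<in> {1, 2, 3} \<and> i' = i + 1 \<and> i \<le> k \<or> j = 1 \<and> j' = 2 \<and> i = k + 1 \<and> i' = k + 1"
| "H_edge k (M i) (U j i') \<longleftrightarrow> i = i' \<and> i \<in> {1..k} \<and> j \<in> {1, 2, 3}"
| "H_edge k (U j i) (V l) \<longleftrightarrow> i = k + 1 \<and> (j, l) \<in> {(1, 1), (2, 1), (3, 2), (3, 3)}"
| "H_edge k (V j) (V l) \<longleftrightarrow> j = 2 \<and> l = 3"
| "H_edge k (V j) (Z l) \<longleftrightarrow> j = l \<and> j \<in> {1, 2, 3}"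
| "H_edge k (B h) (Z j) \<longleftrightarrow> h \<in> {1, 2} \<and> j \<in> {1, 2, 3}"
| "H_edge k _ _ \<longleftrightarrow> False"

lemma H_arcs: "parcs (H k) = {(v, w). H_edge k v w \<or> H_edge k w v}"
proof -
  have strand: "{(U j (i - 1), U j i) | j i. j \<in> {1, 2, 3} \<and> i \<in> {1..k + 1}}
      = {(U j i, U j (i + 1)) | j i. j \<in> {1, 2, 3} \<and> i \<le> k}"
    by (force intro: exI[of _ "_ + 1"])
  define E where "E = {(A h, U j 0) | h j. h \<in> {1, 2} \<and> j \<in> {1, 2, 3}} \<union>
      {(U j i, U j (i + 1)) | j i. j \<in> {1, 2, 3} \<and> i \<le> k} \<union>
      {(M i, U j i) | j i. j \<in> {1, 2, 3} \<and> i \<in> {1..k}} \<union>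
      {(U 1 (k + 1), U 2 (k + 1)), (U 1 (k + 1), V 1), (U 2 (k + 1), V 1)} \<union>
      {(U 3 (k + 1), V 2), (U 3 (k + 1), V 3), (V 2, V 3)} \<union>
      {(V j, Z j) | j. j \<in> {1, 2, 3}} \<union>
      {(B h, Z j) | h j. h \<in> {1, 2} \<and> j \<in> {1, 2, 3}}"
  have "parcs (H k) = E \<union> E\<inverse>"
    unfolding E_def H_def undirected_def strand_indices strand by simp
  moreover have "(v, w) \<in> E \<longleftrightarrow> H_edge k v w" for v w
    unfolding E_def by (cases v; cases w) auto
  ultimately show ?thesis by auto
qed

lemma H_adjacent_iff:
  assumes v: "v \<in> pverts (H k)" and k: "1 \<le> k"
  shows "v \<rightarrow>\<^bsub>H k\<^esub> w \<longleftrightarrow> w \<in> set (nbrs k v)"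
proof -
  have "H_edge k v w \<or> H_edge k w v \<longleftrightarrow> w \<in> set (nbrs k v)"
  proof (cases v)
    case (U j i)
    with v have j: "j = 1 \<or> j = 2 \<or> j = 3" and i: "i \<le> k + 1" by auto
    from i consider "i = 0" | i' where "i = Suc i'" "i' < k" | "i = k + 1"
      by (cases i) (auto simp: le_less)
    then show ?thesis
      using j k unfolding U by cases (elim disjE; cases w; auto)+
  qed (use v k in \<open>cases w; auto\<close>)+
  then show ?thesis by (simp add: H_arcs)
qed

lemma distinct_nbrs: "v \<in> pverts (H k) \<Longrightarrow> distinct (nbrs k v)"
  by (cases v) auto

lemma length_nbrs: "length (nbrs k v) = 3"
  by (cases v) auto

lemma finite_H: "finite (pverts (H k))"
  unfolding H_verts by blast

lemma card_distinct_list: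
  "distinct xs \<Longrightarrow> int (card {x. x \<in> set xs \<and> P x}) = (\<Sum>x\<leftarrow>xs. of_bool (P x))"
  by (simp add: sum_list_distinct_conv_sum_set Int_def)

lemma cubic_H:
  assumes "1 \<le> k"
  shows "cubic_graph (H k)"
proof -
  have edge: "(v, w) \<in> parcs (H k) \<Longrightarrow> v \<in> pverts (H k) \<and> w \<in> pverts (H k) \<and> v \<noteq> w" for v w
    unfolding H_arcs using assms by (cases v; cases w) auto
  then have "parcs (H k) \<subseteq> pverts (H k) \<times> pverts (H k)" by auto
  then have "finite (parcs (H k))" by (rule finite_subset) (simp add: finite_H)
  moreover have "sym (parcs (H k))" unfolding H_arcs by (auto intro: symI)
  ultimately have "pair_graph (H k)"
    using edge by unfold_locales (force simp: finite_H symmetric_def)+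
  moreover have "out_degree (H k) v = 3" if v: "v \<in> pverts (H k)" for v
  proof -
    have "out_arcs (H k) v = Pair v ` set (nbrs k v)"
      using H_adjacent_iff[OF v assms] by (auto simp: out_arcs_def)
    then show ?thesis
      using distinct_nbrs[OF v] length_nbrs[of k v]
      by (simp add: out_degree_def card_image inj_on_def distinct_card)
  qed
  ultimately show ?thesis by (simp add: cubic_graph_def regular_def)
qed

text \<open>
  The excess of a vertex of a cubic graph as a function of four memberships in \<open>S\<close>: its
  own and those of its three neighbours.
\<close>

definition local_excess :: "bool \<Rightarrow> bool \<Rightarrow> bool \<Rightarrow> bool \<Rightarrow> int" where
  "local_excess x a b c = of_bool a + of_bool b + of_bool c - 1 - of_bool x"

lemma excess_H:
  assumes v: "v \<in> pverts (H k)" and k: "1 \<le> k" and "nbrs k v = [x, y, z]"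
  shows "excess (H k) S v = local_excess (v \<in> S) (x \<in> S) (y \<in> S) (z \<in> S)"
proof -
  have "{u \<in> S. v \<rightarrow>\<^bsub>H k\<^esub> u} = {u. u \<in> set (nbrs k v) \<and> u \<in> S}"
    using H_adjacent_iff[OF v k] by auto
  then have "int (card {u \<in> S. v \<rightarrow>\<^bsub>H k\<^esub> u}) = (\<Sum>u\<leftarrow>nbrs k v. of_bool (u \<in> S))"
    using card_distinct_list[OF distinct_nbrs[OF v], of "\<lambda>u. u \<in> S"] by simp
  then show ?thesis by (simp add: assms(3) excess_def local_excess_def)
qed

lemma excess_H_simps:
  assumes "1 \<le> k"
  shows "h \<in> {1, 2} \<Longrightarrow> excess (H k) S (A h)
      = local_excess (A h \<in> S) (U 1 0 \<in> S) (U 2 0 \<in> S) (U 3 0 \<in> S)"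
    and "j \<in> {1, 2, 3} \<Longrightarrow> excess (H k) S (U j 0)
      = local_excess (U j 0 \<in> S) (A 1 \<in> S) (A 2 \<in> S) (U j (Suc 0) \<in> S)"
    and "j \<in> {1, 2, 3} \<Longrightarrow> i < k \<Longrightarrow> excess (H k) S (U j (Suc i))
      = local_excess (U j (Suc i) \<in> S) (M (Suc i) \<in> S) (U j i \<in> S) (U j (Suc (Suc i)) \<in> S)"
    and "i < k \<Longrightarrow> excess (H k) S (M (Suc i))
      = local_excess (M (Suc i) \<in> S) (U 1 (Suc i) \<in> S) (U 2 (Suc i) \<in> S) (U 3 (Suc i) \<in> S)"
    and "excess (H k) S (U 1 (Suc k))
      = local_excess (U 1 (Suc k) \<in> S) (U 1 k \<in> S) (U 2 (Suc k) \<in> S) (V 1 \<in> S)"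
    and "excess (H k) S (U 2 (Suc k))
      = local_excess (U 2 (Suc k) \<in> S) (U 2 k \<in> S) (U 1 (Suc k) \<in> S) (V 1 \<in> S)"
    and "excess (H k) S (U 3 (Suc k))
      = local_excess (U 3 (Suc k) \<in> S) (U 3 k \<in> S) (V 2 \<in> S) (V 3 \<in> S)"
    and "excess (H k) S (V 1)
      = local_excess (V 1 \<in> S) (Z 1 \<in> S) (U 1 (Suc k) \<in> S) (U 2 (Suc k) \<in> S)"
    and "excess (H k) S (V 2)
      = local_excess (V 2 \<in> S) (Z 2 \<in> S) (U 3 (Suc k) \<in> S) (V 3 \<in> S)"
    and "excess (H k) S (V 3)
      = local_excess (V 3 \<in> S) (Z 3 \<in> S) (U 3 (Suc k) \<in> S) (V 2 \<in> S)"
    and "j \<in> {1, 2, 3} \<Longrightarrow> excess (H k) S (Z j)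
      = local_excess (Z j \<in> S) (V j \<in> S) (B 1 \<in> S) (B 2 \<in> S)"
    and "h \<in> {1, 2} \<Longrightarrow> excess (H k) S (B h)
      = local_excess (B h \<in> S) (Z 1 \<in> S) (Z 2 \<in> S) (Z 3 \<in> S)"
  using assms by (auto simp: excess_H)

text \<open>
  The left part of \<open>H k\<close>: the \<open>K\<^sub>2\<^sub>,\<^sub>3\<close> end, which is layer 0, and the layers up to \<open>i\<close>.
  It meets the rest of the graph only in the three strand edges from layer \<open>i\<close> to layer
  \<open>i + 1\<close>.
\<close>

definition arm :: "nat \<Rightarrow> H_vertex set" where
  "arm i = {A 1, A 2} \<union> (\<Union>j\<in>{1, 2, 3}. U j ` {..i}) \<union> M ` {1..i}"

lemma arm_0: "arm 0 = {A 1, A 2, U 1 0, U 2 0, U 3 0}"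
  by (auto simp: arm_def)

lemma arm_Suc: "arm (Suc i) = {M (Suc i), U 1 (Suc i), U 2 (Suc i), U 3 (Suc i)} \<union> arm i"
  by (auto simp: arm_def atMost_Suc atLeastAtMostSuc_conv)

lemma finite_arm: "finite (arm i)"
  by (simp add: arm_def)

lemma sum_arm_0: "sum f (arm 0) = f (A 1) + f (A 2) + f (U 1 0) + f (U 2 0) + f (U 3 0)"
  for f :: "H_vertex \<Rightarrow> int"
  by (simp add: arm_0)

lemma sum_arm_Suc:
  "sum f (arm (Suc i)) =
     sum f (arm i) + f (M (Suc i)) + f (U 1 (Suc i)) + f (U 2 (Suc i)) + f (U 3 (Suc i))"
  for f :: "H_vertex \<Rightarrow> int"
proof -
  have "{M (Suc i), U 1 (Suc i), U 2 (Suc i), U 3 (Suc i)} \<inter> arm i = {}"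
    by (auto simp: arm_def)
  then show ?thesis
    unfolding arm_Suc by (subst sum.union_disjoint) (auto simp: finite_arm)
qed

text \<open>
  The three blocks are the left arm, the two triangles, and the \<open>K\<^sub>2\<^sub>,\<^sub>3\<close> at the right
  end, which is attached to the triangles in the way in which layer 0 is attached to
  layer 1.
\<close>

lemma sum_H:
  "sum f (pverts (H k)) =
     sum f (arm k)
     + (f (U 1 (Suc k)) + f (U 2 (Suc k)) + f (U 3 (Suc k)) + f (V 1) + f (V 2) + f (V 3))
     + (f (B 1) + f (B 2) + f (Z 1) + f (Z 2) + f (Z 3))"
  for f :: "H_vertex \<Rightarrow> int"
proof -
  let ?R = "{U 1 (Suc k), U 2 (Suc k), U 3 (Suc k), V 1, V 2, V 3, B 1, B 2, Z 1, Z 2, Z 3}"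
  have "pverts (H k) = arm k \<union> ?R"
    by (auto simp: H_verts arm_def atMost_Suc)
  moreover have "arm k \<inter> ?R = {}" by (auto simp: arm_def)
  ultimately have "sum f (pverts (H k)) = sum f (arm k) + sum f ?R"
    by (simp only: sum.union_disjoint finite_arm finite.intros)
  then show ?thesis by simp
qed

lemma order_H: "order (H k) = 4 * k + 16"
proof -
  have "sum (\<lambda>_. 1 :: int) (arm i) = 4 * int i + 5" for i
    by (induction i) (simp_all only: sum_arm_0 sum_arm_Suc, simp_all)
  then have "int (order (H k)) = int (4 * k + 16)"
    using sum_H[of "\<lambda>_. 1" k] by simp
  then show ?thesis by (simp only: of_nat_eq_iff)
qed

lemma connected_H:
  assumes k: "1 \<le> k"
  shows "connected (H k)"
proof -
  interpret pair_graph "H k" using cubic_H[OF k] by (simp add: cubic_graph_def)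
  note step = reachable_adj_trans
  have U0: "A 1 \<rightarrow>\<^sup>*\<^bsub>H k\<^esub> U j 0" if "j \<in> {1, 2, 3}" for j
    by (rule reachable_adjI) (use that in \<open>auto simp: H_arcs\<close>)
  have U: "A 1 \<rightarrow>\<^sup>*\<^bsub>H k\<^esub> U j i" if "j \<in> {1, 2, 3}" "i \<le> k + 1" for i j
    using that(2)
  proof (induction i)
    case 0
    show ?case by (rule U0[OF that(1)])
  next
    case (Suc i)
    then have "A 1 \<rightarrow>\<^sup>*\<^bsub>H k\<^esub> U j i" by simp
    then show ?case by (rule step) (use that(1) Suc.prems in \<open>auto simp: H_arcs\<close>)
  qed
  have A: "A 1 \<rightarrow>\<^sup>*\<^bsub>H k\<^esub> A h" if "h \<in> {1, 2}" for h
    by (rule step[OF U[of 1 0]]) (use that in \<open>auto simp: H_arcs\<close>)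
  have M: "A 1 \<rightarrow>\<^sup>*\<^bsub>H k\<^esub> M i" if "i \<in> {1..k}" for i
    by (rule step[OF U[of 1 i]]) (use that in \<open>auto simp: H_arcs\<close>)
  have V: "A 1 \<rightarrow>\<^sup>*\<^bsub>H k\<^esub> V j" if "j \<in> {1, 2, 3}" for j
    by (rule step[OF U[of "if j = 1 then 1 else 3" "k + 1"]]) (use that in \<open>auto simp: H_arcs\<close>)
  have Z: "A 1 \<rightarrow>\<^sup>*\<^bsub>H k\<^esub> Z j" if "j \<in> {1, 2, 3}" for j
    by (rule step[OF V[OF that]]) (use that in \<open>auto simp: H_arcs\<close>)
  have B: "A 1 \<rightarrow>\<^sup>*\<^bsub>H k\<^esub> B h" if "h \<in> {1, 2}" for h
    by (rule step[OF Z[of 1]]) (use that in \<open>auto simp: H_arcs\<close>)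
  have reach: "A 1 \<rightarrow>\<^sup>*\<^bsub>H k\<^esub> v" if "v \<in> pverts (H k)" for v
    using that A U M V Z B by (cases v) auto
  have "strongly_connected (H k)"
  proof (rule strongly_connectedI)
    show "verts (H k) \<noteq> {}" by (auto simp: H_verts)
  next
    fix u v assume "u \<in> verts (H k)" "v \<in> verts (H k)"
    then have "A 1 \<rightarrow>\<^sup>*\<^bsub>H k\<^esub> u" "A 1 \<rightarrow>\<^sup>*\<^bsub>H k\<^esub> v" using reach by auto
    then show "u \<rightarrow>\<^sup>*\<^bsub>H k\<^esub> v"
      using symmetric_reachable'[of "A 1" u] reachable_trans by blast
  qed
  then show ?thesis
    using sym_arcs by (simp add: connected_def strongly_connected_def reachable_mk_symmetric_eq)
qed

section \<open>Dominating sets: the lower bound\<close>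

definition two_among :: "bool \<Rightarrow> bool \<Rightarrow> bool \<Rightarrow> bool" where
  "two_among x y z \<longleftrightarrow> x \<and> y \<or> x \<and> z \<or> y \<and> z"

text \<open>
  The least total excess of a \<open>K\<^sub>2\<^sub>,\<^sub>3\<close> end whose three attached vertices have
  memberships \<open>z\<close> and are continued by \<open>v\<close>. If \<open>b\<close> of the two centres lie in \<open>S\<close>, then
  the excesses add up to \<open>|z| + |v| + 2 b - 5\<close>. The case \<open>b = 0\<close> is impossible: a vertex
  that dominates a centre has just one neighbour besides the centres, so it cannot have
  two in \<open>S\<close>. In the case \<open>b = 1\<close> every \<open>z\<close> in \<open>S\<close> needs its continuation in \<open>S\<close>.
\<close>

definition end_bound :: "bool \<Rightarrow> bool \<Rightarrow> bool \<Rightarrow> bool \<Rightarrow> bool \<Rightarrow> bool \<Rightarrow> int" where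
  "end_bound z1 z2 z3 v1 v2 v3 =
     of_bool z1 + of_bool z2 + of_bool z3 + of_bool v1 + of_bool v2 + of_bool v3 - 1
     - 2 * of_bool ((z1 \<longrightarrow> v1) \<and> (z2 \<longrightarrow> v2) \<and> (z3 \<longrightarrow> v3))"

text \<open>
  This and the other statements about memberships are decided by trying all of them. The
  quantifiers are nested so that conditions on few variables are tested before the
  remaining variables get values, which discards most branches early.
\<close>

lemma K23_end_dominated [rule_format]:
  "\<forall>b1 b2 z1 z2 z3. 0 \<le> local_excess b1 z1 z2 z3 \<longrightarrow> 0 \<le> local_excess b2 z1 z2 z3 \<longrightarrow>
    (\<forall>v1 v2 v3. 0 \<le> local_excess z1 b1 b2 v1 \<longrightarrow> 0 \<le> local_excess z2 b1 b2 v2 \<longrightarrow>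
       0 \<le> local_excess z3 b1 b2 v3 \<longrightarrow>
     two_among z1 z2 z3 \<and>
     end_bound z1 z2 z3 v1 v2 v3 \<le> local_excess b1 z1 z2 z3 + local_excess b2 z1 z2 z3
       + local_excess z1 b1 b2 v1 + local_excess z2 b1 b2 v2 + local_excess z3 b1 b2 v3)"
  unfolding local_excess_def end_bound_def two_among_def by (simp add: all_bool_eq)

text \<open>
  The memberships \<open>p\<close> of the last layer of an arm and \<open>u\<close> of the following layer that
  can occur: the last layer is not avoided, and if only one of its vertices is in \<open>S\<close>,
  then that strand continues in \<open>S\<close>.
\<close>

definition arm_feasible :: "bool \<Rightarrow> bool \<Rightarrow> bool \<Rightarrow> bool \<Rightarrow> bool \<Rightarrow> bool \<Rightarrow> bool" where
  "arm_feasible p1 p2 p3 u1 u2 u3 \<longleftrightarrow> two_among p1 p2 p3 \<or> p1 \<and> u1 \<or> p2 \<and> u2 \<or> p3 \<and> u3"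

text \<open>
  A potential for the total excess of an arm. It is coarser than the true minimum for
  given \<open>p\<close> and \<open>u\<close>, yet strong enough to reproduce itself when the arm grows by a
  layer.
\<close>

definition arm_bound :: "bool \<Rightarrow> bool \<Rightarrow> bool \<Rightarrow> bool \<Rightarrow> bool \<Rightarrow> bool \<Rightarrow> int" where
  "arm_bound p1 p2 p3 u1 u2 u3 =
     (if p1 \<and> p2 \<and> p3 then 3 else if u1 \<or> u2 \<or> u3 then 2 else 1)"

text \<open>
  The potential is valid only from layer 1 on: at layer 0 the excess can be 1 although
  the strands continue in \<open>S\<close>. The sharper bound for the end compensates for that.
\<close>

lemma arm_bound_start [rule_format]:
  "\<forall>p1 p2 p3. two_among p1 p2 p3 \<longrightarrow>
    (\<forall>m u1 u2 u3. 0 \<le> local_excess m u1 u2 u3 \<longrightarrow>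
    (\<forall>w1 w2 w3. 0 \<le> local_excess u1 m p1 w1 \<longrightarrow> 0 \<le> local_excess u2 m p2 w2 \<longrightarrow>
       0 \<le> local_excess u3 m p3 w3 \<longrightarrow>
     arm_feasible u1 u2 u3 w1 w2 w3 \<and>
     arm_bound u1 u2 u3 w1 w2 w3 \<le> end_bound p1 p2 p3 u1 u2 u3 + local_excess m u1 u2 u3
       + local_excess u1 m p1 w1 + local_excess u2 m p2 w2 + local_excess u3 m p3 w3))"
  unfolding local_excess_def end_bound_def arm_bound_def arm_feasible_def two_among_def
  by (simp add: all_bool_eq)

lemma arm_bound_step [rule_format]:
  "\<forall>m u1 u2 u3. 0 \<le> local_excess m u1 u2 u3 \<longrightarrow>
    (\<forall>p1 p2 p3. arm_feasible p1 p2 p3 u1 u2 u3 \<longrightarrow>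
    (\<forall>w1 w2 w3. 0 \<le> local_excess u1 m p1 w1 \<longrightarrow> 0 \<le> local_excess u2 m p2 w2 \<longrightarrow>
       0 \<le> local_excess u3 m p3 w3 \<longrightarrow>
     arm_feasible u1 u2 u3 w1 w2 w3 \<and>
     arm_bound u1 u2 u3 w1 w2 w3 \<le> arm_bound p1 p2 p3 u1 u2 u3 + local_excess m u1 u2 u3
       + local_excess u1 m p1 w1 + local_excess u2 m p2 w2 + local_excess u3 m p3 w3))"
  unfolding local_excess_def arm_bound_def arm_feasible_def two_among_def
  by (simp add: all_bool_eq)

text \<open>
  Five suffices, because the total excess of \<open>H k\<close> is even.
\<close>

lemma gadget_bound [rule_format]:
  "\<forall>z1 z2 z3. two_among z1 z2 z3 \<longrightarrow>
    (\<forall>v1 v2 v3 u1 u2 u3. 0 \<le> local_excess v1 z1 u1 u2 \<longrightarrow> 0 \<le> local_excess v2 z2 u3 v3 \<longrightarrow>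
       0 \<le> local_excess v3 z3 u3 v2 \<longrightarrow>
    (\<forall>p1 p2 p3. 0 \<le> local_excess u1 p1 u2 v1 \<longrightarrow> 0 \<le> local_excess u2 p2 u1 v1 \<longrightarrow>
       0 \<le> local_excess u3 p3 v2 v3 \<longrightarrow> arm_feasible p1 p2 p3 u1 u2 u3 \<longrightarrow>
     5 \<le> arm_bound p1 p2 p3 u1 u2 u3
       + (local_excess u1 p1 u2 v1 + local_excess u2 p2 u1 v1 + local_excess u3 p3 v2 v3
          + local_excess v1 z1 u1 u2 + local_excess v2 z2 u3 v3 + local_excess v3 z3 u3 v2)
       + end_bound z1 z2 z3 v1 v2 v3))"
  unfolding local_excess_def end_bound_def arm_bound_def arm_feasible_def two_among_def
  by (simp add: all_bool_eq)

lemma dominating_arm: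
  assumes dom: "\<And>v. v \<in> pverts (H k) \<Longrightarrow> 0 \<le> excess (H k) S v" and i: "i < k"
  shows "arm_feasible (U 1 (Suc i) \<in> S) (U 2 (Suc i) \<in> S) (U 3 (Suc i) \<in> S)
           (U 1 (Suc (Suc i)) \<in> S) (U 2 (Suc (Suc i)) \<in> S) (U 3 (Suc (Suc i)) \<in> S) \<and>
         arm_bound (U 1 (Suc i) \<in> S) (U 2 (Suc i) \<in> S) (U 3 (Suc i) \<in> S)
           (U 1 (Suc (Suc i)) \<in> S) (U 2 (Suc (Suc i)) \<in> S) (U 3 (Suc (Suc i)) \<in> S)
         \<le> sum (excess (H k) S) (arm (Suc i))"
  using i
proof (induction i)
  case 0
  then have k: "1 \<le> k" by simp
  note ex = excess_H_simps[OF k]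
  have "two_among (U 1 0 \<in> S) (U 2 0 \<in> S) (U 3 0 \<in> S) \<and>
    end_bound (U 1 0 \<in> S) (U 2 0 \<in> S) (U 3 0 \<in> S) (U 1 (Suc 0) \<in> S) (U 2 (Suc 0) \<in> S) (U 3 (Suc 0) \<in> S)
    \<le> sum (excess (H k) S) (arm 0)"
    using K23_end_dominated[of "A 1 \<in> S" "U 1 0 \<in> S" "U 2 0 \<in> S" "U 3 0 \<in> S" "A 2 \<in> S"
        "U 1 (Suc 0) \<in> S" "U 2 (Suc 0) \<in> S" "U 3 (Suc 0) \<in> S"]
      dom[of "A 1"] dom[of "A 2"] dom[of "U 1 0"] dom[of "U 2 0"] dom[of "U 3 0"]
    by (simp del: One_nat_def add: sum_arm_0 ex)
  then show ?case
    using arm_bound_start[of "U 1 0 \<in> S" "U 2 0 \<in> S" "U 3 0 \<in> S" "M (Suc 0) \<in> S"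
        "U 1 (Suc 0) \<in> S" "U 2 (Suc 0) \<in> S" "U 3 (Suc 0) \<in> S" "U 1 (Suc (Suc 0)) \<in> S" "U 2 (Suc (Suc 0)) \<in> S" "U 3 (Suc (Suc 0)) \<in> S"]
      dom[of "M (Suc 0)"] dom[of "U 1 (Suc 0)"] dom[of "U 2 (Suc 0)"] dom[of "U 3 (Suc 0)"] 0
    by (simp del: One_nat_def add: sum_arm_Suc ex)
next
  case (Suc i)
  then have k: "1 \<le> k" and "Suc i < k" by simp_all
  note ex = excess_H_simps[OF k]
  show ?case
    using Suc.IH
      arm_bound_step[of "M (Suc (Suc i)) \<in> S"
        "U 1 (Suc (Suc i)) \<in> S" "U 2 (Suc (Suc i)) \<in> S" "U 3 (Suc (Suc i)) \<in> S"
        "U 1 (Suc i) \<in> S" "U 2 (Suc i) \<in> S" "U 3 (Suc i) \<in> S"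
        "U 1 (Suc (Suc (Suc i))) \<in> S" "U 2 (Suc (Suc (Suc i))) \<in> S" "U 3 (Suc (Suc (Suc i))) \<in> S"]
      dom[of "M (Suc (Suc i))"]
      dom[of "U 1 (Suc (Suc i))"] dom[of "U 2 (Suc (Suc i))"] dom[of "U 3 (Suc (Suc i))"]
      \<open>Suc i < k\<close>
    by (simp del: One_nat_def add: sum_arm_Suc[of _ "Suc i"] ex)
qed

lemma dominating_H_card:
  assumes k: "1 \<le> k" and "dominating12 (H k) S"
  shows "2 * k + 11 \<le> card S"
proof -
  note cubic = cubic_H[OF k]
  have S: "S \<subseteq> pverts (H k)" and dom: "\<And>v. v \<in> pverts (H k) \<Longrightarrow> 0 \<le> excess (H k) S v"
    using assms(2) unfolding dominating12_iff_excess[OF cubic] by auto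
  note ex = excess_H_simps[OF k]
  let ?R = "sum (excess (H k) S) {B 1, B 2, Z 1, Z 2, Z 3}"
  have left: "arm_feasible (U 1 k \<in> S) (U 2 k \<in> S) (U 3 k \<in> S)
       (U 1 (Suc k) \<in> S) (U 2 (Suc k) \<in> S) (U 3 (Suc k) \<in> S) \<and>
     arm_bound (U 1 k \<in> S) (U 2 k \<in> S) (U 3 k \<in> S)
       (U 1 (Suc k) \<in> S) (U 2 (Suc k) \<in> S) (U 3 (Suc k) \<in> S)
     \<le> sum (excess (H k) S) (arm k)"
    using dominating_arm[OF dom, of "k - 1"] k by simp
  have right: "two_among (Z 1 \<in> S) (Z 2 \<in> S) (Z 3 \<in> S) \<and>
    end_bound (Z 1 \<in> S) (Z 2 \<in> S) (Z 3 \<in> S) (V 1 \<in> S) (V 2 \<in> S) (V 3 \<in> S) \<le> ?R"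
    using K23_end_dominated[of "B 1 \<in> S" "Z 1 \<in> S" "Z 2 \<in> S" "Z 3 \<in> S" "B 2 \<in> S"
        "V 1 \<in> S" "V 2 \<in> S" "V 3 \<in> S"]
      dom[of "B 1"] dom[of "B 2"] dom[of "Z 1"] dom[of "Z 2"] dom[of "Z 3"]
    by (simp del: One_nat_def add: ex local_excess_def add.commute add.left_commute)
  have "5 \<le> sum (excess (H k) S) (pverts (H k))"
    using left right
      gadget_bound[of "Z 1 \<in> S" "Z 2 \<in> S" "Z 3 \<in> S" "V 1 \<in> S" "U 1 (Suc k) \<in> S" "U 2 (Suc k) \<in> S"
        "V 2 \<in> S" "U 3 (Suc k) \<in> S" "V 3 \<in> S" "U 1 k \<in> S" "U 2 k \<in> S" "U 3 k \<in> S"]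
      dom[of "U 1 (Suc k)"] dom[of "U 2 (Suc k)"] dom[of "U 3 (Suc k)"]
      dom[of "V 1"] dom[of "V 2"] dom[of "V 3"]
    by (simp del: One_nat_def add: sum_H ex)
  then show ?thesis
    unfolding sum_excess[OF cubic S] order_H by simp
qed

section \<open>Induced cycles: the upper bound\<close>

text \<open>
  The cycles cross between two layers an even number of times. This is the form of that
  parity which is preserved from layer to layer: the last layer of an arm contains no
  vertex of \<open>S\<close> or exactly two, and these two strands both continue in \<open>S\<close> or both do
  not.
\<close>

definition paired :: "bool \<Rightarrow> bool \<Rightarrow> bool \<Rightarrow> bool \<Rightarrow> bool \<Rightarrow> bool \<Rightarrow> bool" where
  "paired p1 p2 p3 u1 u2 u3 \<longleftrightarrow>
     \<not> p1 \<and> \<not> p2 \<and> \<not> p3 \<or>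
     p1 \<and> p2 \<and> \<not> p3 \<and> u1 = u2 \<or> p1 \<and> p3 \<and> \<not> p2 \<and> u1 = u3 \<or> p2 \<and> p3 \<and> \<not> p1 \<and> u2 = u3"

text \<open>
  The arm itself contributes at most \<open>|p| - 1\<close>. In addition, a vertex of the last layer
  outside \<open>S\<close> gains one if its strand continues in \<open>S\<close>, which replaces \<open>|p|\<close> by the
  number of strands that \<open>p\<close> or \<open>u\<close> meets. For a vertex in \<open>S\<close> the continuation is
  already included, because its excess is 0.
\<close>

definition cycle_bound :: "bool \<Rightarrow> bool \<Rightarrow> bool \<Rightarrow> bool \<Rightarrow> bool \<Rightarrow> bool \<Rightarrow> int" where
  "cycle_bound p1 p2 p3 u1 u2 u3 = of_bool (p1 \<or> u1) + of_bool (p2 \<or> u2) + of_bool (p3 \<or> u3) - 1"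

lemma K23_end_cycles [rule_format]:
  "\<forall>b1 b2 z1 z2 z3. (b1 \<longrightarrow> local_excess b1 z1 z2 z3 = 0) \<longrightarrow> (b2 \<longrightarrow> local_excess b2 z1 z2 z3 = 0) \<longrightarrow>
    (\<forall>v1 v2 v3. (z1 \<longrightarrow> local_excess z1 b1 b2 v1 = 0) \<longrightarrow> (z2 \<longrightarrow> local_excess z2 b1 b2 v2 = 0) \<longrightarrow>
       (z3 \<longrightarrow> local_excess z3 b1 b2 v3 = 0) \<longrightarrow>
     paired z1 z2 z3 v1 v2 v3 \<and>
     local_excess b1 z1 z2 z3 + local_excess b2 z1 z2 z3
       + local_excess z1 b1 b2 v1 + local_excess z2 b1 b2 v2 + local_excess z3 b1 b2 v3
     \<le> cycle_bound z1 z2 z3 v1 v2 v3)"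
  unfolding local_excess_def cycle_bound_def paired_def by (simp del: One_nat_def add: all_bool_eq)

lemma cycle_bound_step [rule_format]:
  "\<forall>m u1 u2 u3. (m \<longrightarrow> local_excess m u1 u2 u3 = 0) \<longrightarrow>
    (\<forall>p1 p2 p3. paired p1 p2 p3 u1 u2 u3 \<longrightarrow>
    (\<forall>w1 w2 w3. (u1 \<longrightarrow> local_excess u1 m p1 w1 = 0) \<longrightarrow> (u2 \<longrightarrow> local_excess u2 m p2 w2 = 0) \<longrightarrow>
       (u3 \<longrightarrow> local_excess u3 m p3 w3 = 0) \<longrightarrow>
     paired u1 u2 u3 w1 w2 w3 \<and>
     cycle_bound p1 p2 p3 u1 u2 u3 + local_excess m u1 u2 u3
       + local_excess u1 m p1 w1 + local_excess u2 m p2 w2 + local_excess u3 m p3 w3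
     \<le> cycle_bound u1 u2 u3 w1 w2 w3))"
  unfolding local_excess_def cycle_bound_def paired_def by (simp del: One_nat_def add: all_bool_eq)

lemma gadget_cycles [rule_format]:
  "\<forall>z1 z2 z3 v1 v2 v3. paired z1 z2 z3 v1 v2 v3 \<longrightarrow>
    (\<forall>u1 u2 u3. (v1 \<longrightarrow> local_excess v1 z1 u1 u2 = 0) \<longrightarrow> (v2 \<longrightarrow> local_excess v2 z2 u3 v3 = 0) \<longrightarrow>
       (v3 \<longrightarrow> local_excess v3 z3 u3 v2 = 0) \<longrightarrow>
    (\<forall>p1 p2 p3. paired p1 p2 p3 u1 u2 u3 \<longrightarrow>
       (u1 \<longrightarrow> local_excess u1 p1 u2 v1 = 0) \<longrightarrow> (u2 \<longrightarrow> local_excess u2 p2 u1 v1 = 0) \<longrightarrow>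
       (u3 \<longrightarrow> local_excess u3 p3 v2 v3 = 0) \<longrightarrow>
     cycle_bound p1 p2 p3 u1 u2 u3
       + (local_excess u1 p1 u2 v1 + local_excess u2 p2 u1 v1 + local_excess u3 p3 v2 v3
          + local_excess v1 z1 u1 u2 + local_excess v2 z2 u3 v3 + local_excess v3 z3 u3 v2)
       + cycle_bound z1 z2 z3 v1 v2 v3 \<le> 4))"
  unfolding local_excess_def cycle_bound_def paired_def by (simp del: One_nat_def add: all_bool_eq)

lemma cycles_arm:
  assumes cyc: "\<And>v. v \<in> S \<Longrightarrow> excess (H k) S v = 0" and k: "1 \<le> k" and i: "i \<le> k"
  shows "paired (U 1 i \<in> S) (U 2 i \<in> S) (U 3 i \<in> S)
           (U 1 (Suc i) \<in> S) (U 2 (Suc i) \<in> S) (U 3 (Suc i) \<in> S) \<and>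
         sum (excess (H k) S) (arm i) \<le>
         cycle_bound (U 1 i \<in> S) (U 2 i \<in> S) (U 3 i \<in> S)
           (U 1 (Suc i) \<in> S) (U 2 (Suc i) \<in> S) (U 3 (Suc i) \<in> S)"
  using i
proof (induction i)
  note ex = excess_H_simps[OF k]
  case 0
  show ?case
    using K23_end_cycles[of "A 1 \<in> S" "U 1 0 \<in> S" "U 2 0 \<in> S" "U 3 0 \<in> S" "A 2 \<in> S"
        "U 1 (Suc 0) \<in> S" "U 2 (Suc 0) \<in> S" "U 3 (Suc 0) \<in> S"]
      cyc[of "A 1"] cyc[of "A 2"] cyc[of "U 1 0"] cyc[of "U 2 0"] cyc[of "U 3 0"]
    by (simp del: One_nat_def add: sum_arm_0 ex)
next
  note ex = excess_H_simps[OF k]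
  case (Suc i)
  then have "i < k" by simp
  show ?case
    using Suc
      cycle_bound_step[of "M (Suc i) \<in> S" "U 1 (Suc i) \<in> S" "U 2 (Suc i) \<in> S" "U 3 (Suc i) \<in> S"
        "U 1 i \<in> S" "U 2 i \<in> S" "U 3 i \<in> S"
        "U 1 (Suc (Suc i)) \<in> S" "U 2 (Suc (Suc i)) \<in> S" "U 3 (Suc (Suc i)) \<in> S"]
      cyc[of "M (Suc i)"] cyc[of "U 1 (Suc i)"] cyc[of "U 2 (Suc i)"] cyc[of "U 3 (Suc i)"]
    by (simp del: One_nat_def add: sum_arm_Suc ex \<open>i < k\<close>)
qed

lemma induced_cycles_H_card:
  assumes k: "1 \<le> k" and S: "S \<subseteq> pverts (H k)" and "regular 2 (H k \<restriction> S)"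
  shows "card S \<le> 2 * k + 10"
proof -
  note cubic = cubic_H[OF k]
  have cyc: "\<And>v. v \<in> S \<Longrightarrow> excess (H k) S v = 0"
    using assms(3) unfolding regular2_induced_iff_excess by auto
  note ex = excess_H_simps[OF k]
  let ?R = "sum (excess (H k) S) {B 1, B 2, Z 1, Z 2, Z 3}"
  have right: "paired (Z 1 \<in> S) (Z 2 \<in> S) (Z 3 \<in> S) (V 1 \<in> S) (V 2 \<in> S) (V 3 \<in> S) \<and>
    ?R \<le> cycle_bound (Z 1 \<in> S) (Z 2 \<in> S) (Z 3 \<in> S) (V 1 \<in> S) (V 2 \<in> S) (V 3 \<in> S)"
    using K23_end_cycles[of "B 1 \<in> S" "Z 1 \<in> S" "Z 2 \<in> S" "Z 3 \<in> S" "B 2 \<in> S"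
        "V 1 \<in> S" "V 2 \<in> S" "V 3 \<in> S"]
      cyc[of "B 1"] cyc[of "B 2"] cyc[of "Z 1"] cyc[of "Z 2"] cyc[of "Z 3"]
    by (simp del: One_nat_def add: ex local_excess_def add.commute add.left_commute)
  have "sum (excess (H k) S) (pverts (H k)) \<le> 4"
    using right cycles_arm[OF cyc k, of k]
      gadget_cycles[of "Z 1 \<in> S" "Z 2 \<in> S" "Z 3 \<in> S" "V 1 \<in> S" "V 2 \<in> S" "V 3 \<in> S"
        "U 1 (Suc k) \<in> S" "U 2 (Suc k) \<in> S" "U 3 (Suc k) \<in> S" "U 1 k \<in> S" "U 2 k \<in> S" "U 3 k \<in> S"]
      cyc[of "U 1 (Suc k)"] cyc[of "U 2 (Suc k)"] cyc[of "U 3 (Suc k)"]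
      cyc[of "V 1"] cyc[of "V 2"] cyc[of "V 3"]
    by (simp del: One_nat_def add: sum_H ex)
  then show ?thesis
    unfolding sum_excess[OF cubic S] order_H by simp
qed

section \<open>Optimal sets\<close>

text \<open>
  One cycle that runs along the strands 1 and 3 and closes at both ends. Leaving out
  strand 2 avoids the edge between the strands 1 and 2, which would be a chord.
\<close>

definition long_cycle :: "nat \<Rightarrow> H_vertex set" where
  "long_cycle k = {A 1, V 1, V 2, Z 1, Z 2, B 1} \<union> U 1 ` {..k + 1} \<union> U 3 ` {..k + 1}"

lemma long_cycle_induced:
  assumes k: "1 \<le> k"
  shows "long_cycle k \<subseteq> pverts (H k)" and "regular 2 (H k \<restriction> long_cycle k)"
    and "card (long_cycle k) = 2 * k + 10"
proof -
  show "long_cycle k \<subseteq> pverts (H k)"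
    by (auto simp: long_cycle_def)
  have strand: "excess (H k) (long_cycle k) (U j i) = 0" if "j \<in> {1, 3}" "i \<le> k + 1" for i j
  proof -
    from \<open>i \<le> k + 1\<close> consider "i = 0" | i' where "i = Suc i'" "i' < k" | "i = Suc k"
      by (cases i) (auto simp: le_less)
    then show ?thesis
      using \<open>j \<in> {1, 3}\<close> k
      by cases (auto simp del: One_nat_def simp: excess_H_simps[OF k] local_excess_def long_cycle_def)
  qed
  then show "regular 2 (H k \<restriction> long_cycle k)"
    unfolding regular2_induced_iff_excess
    by (auto simp del: One_nat_def simp: long_cycle_def excess_H_simps[OF k] local_excess_def)
  have "card (U j ` {..k + 1}) = k + 2" for j
    by (simp add: card_image inj_on_def)
  moreover have "U 1 ` {..k + 1} \<inter> U 3 ` {..k + 1} = {}"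
    and "{A 1, V 1, V 2, Z 1, Z 2, B 1} \<inter> (U 1 ` {..k + 1} \<union> U 3 ` {..k + 1}) = {}"
    by auto
  ultimately show "card (long_cycle k) = 2 * k + 10"
    unfolding long_cycle_def Un_assoc by (subst card_Un_disjoint, simp, simp, simp, subst card_Un_disjoint) simp_all
qed

text \<open>
  At distance \<open>d\<close> from layer \<open>k + 1\<close> the optimal dominating set follows one strand for
  even \<open>d\<close> and two strands together with the claw centre for odd \<open>d\<close>. It forms a single
  path that stays on a strand for three layers and then changes through a claw centre to
  the next strand in the cyclic order 2, 3, 1. In the interior every vertex of the path
  has two neighbours on it, and every other vertex has exactly one.
\<close>

definition on_snake :: "nat \<Rightarrow> nat \<Rightarrow> bool" where
  "on_snake d j \<longleftrightarrow>
     d mod 6 \<in> (if j = 2 then {5, 0, 1} else if j = 3 then {1, 2, 3} else {3, 4, 5})"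

lemma snake_layer:
  assumes "j \<in> {1, 2, 3}"
  shows "local_excess (on_snake (Suc d) j) (odd (Suc d)) (on_snake (Suc (Suc d)) j) (on_snake d j) = 0"
    and "local_excess (odd d) (on_snake d 1) (on_snake d 2) (on_snake d 3) = 0"
proof -
  have odd: "odd d \<longleftrightarrow> d mod 6 \<in> {1, 3, 5}" by (auto, presburger+)
  have "d mod 6 \<in> {0, 1, 2, 3, 4, 5}" by auto
  then show "local_excess (on_snake (Suc d) j) (odd (Suc d)) (on_snake (Suc (Suc d)) j) (on_snake d j) = 0"
    and "local_excess (odd d) (on_snake d 1) (on_snake d 2) (on_snake d 3) = 0"
    using assms unfolding even_Suc odd on_snake_def local_excess_def
    by (elim insertE; simp add: mod_Suc)+
qed

text \<open>
  The path can be closed off at layer 0 where it occupies two strands: the two centres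
  of the \<open>K\<^sub>2\<^sub>,\<^sub>3\<close> join the set. This happens for even \<open>k\<close>, and \<open>d = k\<close> is then the
  distance of layer 1.
\<close>

lemma snake_start_even:
  assumes "even d"
  defines "s \<equiv> on_snake (Suc d)" and "t \<equiv> on_snake d"
  shows "local_excess True (s 1) (s 2) (s 3) = 0"
    and "j \<in> {1, 2, 3} \<Longrightarrow> 0 \<le> local_excess (s j) True True (t j)"
    and "local_excess (s 1) True True (t 1) + local_excess (s 2) True True (t 2)
      + local_excess (s 3) True True (t 3) = 2"
proof -
  have "d mod 6 \<in> {0, 2, 4}" using \<open>even d\<close> by (auto, presburger+)
  then show "local_excess True (s 1) (s 2) (s 3) = 0"
    and "j \<in> {1, 2, 3} \<Longrightarrow> 0 \<le> local_excess (s j) True True (t j)"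
    and "local_excess (s 1) True True (t 1) + local_excess (s 2) True True (t 2)
      + local_excess (s 3) True True (t 3) = 2"
    unfolding s_def t_def on_snake_def local_excess_def
    by (elim insertE; simp add: mod_Suc)+
qed

text \<open>
  For odd \<open>k\<close> the pattern would have only one strand at layer 0. Layer 0 repeats layer 1
  instead, and a single centre joins the set. Here \<open>d\<close> is the distance of layer 2.
\<close>

lemma snake_start_odd:
  assumes "even d"
  defines "s \<equiv> on_snake (Suc d)" and "t \<equiv> on_snake d"
  shows "local_excess False (s 1) (s 2) (s 3) = 1"
    and "local_excess True (s 1) (s 2) (s 3) = 0"
    and "local_excess (s j) False True (s j) = 0"
    and "j \<in> {1, 2, 3} \<Longrightarrow> 0 \<le> local_excess (s j) True (s j) (t j)"
    and "local_excess (s 1) True (s 1) (t 1) + local_excess (s 2) True (s 2) (t 2)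
      + local_excess (s 3) True (s 3) (t 3) = 1"
proof -
  have "d mod 6 \<in> {0, 2, 4}" using \<open>even d\<close> by (auto, presburger+)
  then show "local_excess False (s 1) (s 2) (s 3) = 1"
    and "local_excess True (s 1) (s 2) (s 3) = 0"
    and "j \<in> {1, 2, 3} \<Longrightarrow> 0 \<le> local_excess (s j) True (s j) (t j)"
    and "local_excess (s 1) True (s 1) (t 1) + local_excess (s 2) True (s 2) (t 2)
      + local_excess (s 3) True (s 3) (t 3) = 1"
    unfolding s_def t_def on_snake_def local_excess_def
    by (elim insertE; simp add: mod_Suc)+
  show "local_excess (s j) False True (s j) = 0" by (simp add: local_excess_def)
qed

text \<open>
  At the right end the pattern arrives on strand 2 alone, and it is completed by \<open>V 1\<close>
  and the whole \<open>K\<^sub>2\<^sub>,\<^sub>3\<close>. This contributes an excess of 4; the other 2 come from the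
  left end.
\<close>

definition snake :: "nat \<Rightarrow> H_vertex set" where
  "snake k =
     {U j i | j i. j \<in> {1, 2, 3} \<and> i \<le> k + 1 \<and> on_snake (if i = 0 \<and> odd k then k else k + 1 - i) j}
     \<union> {M i | i. i \<in> {1..k} \<and> odd (k + 1 - i)} \<union> {A h | h. h = 2 \<or> h = 1 \<and> even k}
     \<union> {V 1, Z 1, Z 2, Z 3, B 1, B 2}"

lemma in_snake:
  "A h \<in> snake k \<longleftrightarrow> h = 2 \<or> h = 1 \<and> even k"
  "U j i \<in> snake k \<longleftrightarrow> j \<in> {1, 2, 3} \<and> i \<le> Suc k \<and>
     on_snake (if i = 0 \<and> odd k then k else Suc k - i) j"
  "M i \<in> snake k \<longleftrightarrow> i \<in> {1..k} \<and> odd (Suc k - i)"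
  "V j \<in> snake k \<longleftrightarrow> j = 1"
  "Z j \<in> snake k \<longleftrightarrow> j \<in> {1, 2, 3}"
  "B h \<in> snake k \<longleftrightarrow> h \<in> {1, 2}"
  by (auto simp: snake_def)

lemma snake_dominating:
  assumes k: "1 \<le> k"
  shows "dominating12 (H k) (snake k)" and "card (snake k) = 2 * k + 11"
proof -
  let ?e = "excess (H k) (snake k)"
  note ex = excess_H_simps[OF k]
  note cubic = cubic_H[OF k]
  have sub: "snake k \<subseteq> pverts (H k)" by (auto simp: snake_def)
  have layer: "?e (M (Suc i)) = 0" "j \<in> {1, 2, 3} \<Longrightarrow> i \<noteq> 0 \<or> even k \<Longrightarrow> ?e (U j (Suc i)) = 0"
    if "i < k" for i j
  proof -
    obtain d where "k = Suc (i + d)" using \<open>i < k\<close> by (metis less_iff_Suc_add)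
    then have d: "Suc k - i = Suc (Suc d)" "k - i = Suc d" "k - Suc i = d" "Suc i \<le> k" "i \<le> k" "i \<le> Suc k"
      by simp_all
    show "?e (M (Suc i)) = 0"
      using snake_layer(2)[of 1 "Suc d"]
      by (simp del: One_nat_def add: ex \<open>i < k\<close> in_snake d)
    show "?e (U j (Suc i)) = 0" if "j \<in> {1, 2, 3}" "i \<noteq> 0 \<or> even k"
      using snake_layer(1)[of j d] that
      by (auto simp del: One_nat_def simp: ex \<open>i < k\<close> in_snake d)
  qed
  \<comment> \<open>The left end has excess 2 in total. For odd \<open>k\<close> one unit of it falls on layer 1.\<close>
  have first: "0 \<le> ?e (A 1)" "0 \<le> ?e (A 2)" "0 \<le> ?e (U 1 0)" "0 \<le> ?e (U 2 0)" "0 \<le> ?e (U 3 0)"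
    "?e (A 1) + ?e (A 2) + ?e (U 1 0) + ?e (U 2 0) + ?e (U 3 0) = (if even k then 2 else 1)"
  proof -
    have "0 \<le> ?e (A 1) \<and> 0 \<le> ?e (A 2) \<and> 0 \<le> ?e (U 1 0) \<and> 0 \<le> ?e (U 2 0) \<and> 0 \<le> ?e (U 3 0) \<and>
      ?e (A 1) + ?e (A 2) + ?e (U 1 0) + ?e (U 2 0) + ?e (U 3 0) = (if even k then 2 else 1)"
    proof (cases "even k")
      case True
      then show ?thesis
        using snake_start_even(1,3)[OF True] snake_start_even(2)[OF True, of 1]
          snake_start_even(2)[OF True, of 2] snake_start_even(2)[OF True, of 3]
        by (simp del: One_nat_def add: ex in_snake)
    next
      case False
      then have d: "Suc (k - 1) = k" "even (k - 1)" by auto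
      show ?thesis
        using snake_start_odd[OF d(2), unfolded d(1)] False
        by (simp del: One_nat_def add: ex in_snake)
    qed
    then show "0 \<le> ?e (A 1)" "0 \<le> ?e (A 2)" "0 \<le> ?e (U 1 0)" "0 \<le> ?e (U 2 0)" "0 \<le> ?e (U 3 0)"
      "?e (A 1) + ?e (A 2) + ?e (U 1 0) + ?e (U 2 0) + ?e (U 3 0) = (if even k then 2 else 1)"
      by blast+
  qed
  have second: "0 \<le> ?e (U 1 (Suc 0))" "0 \<le> ?e (U 2 (Suc 0))" "0 \<le> ?e (U 3 (Suc 0))"
    "?e (U 1 (Suc 0)) + ?e (U 2 (Suc 0)) + ?e (U 3 (Suc 0)) = 1" if "odd k"
  proof -
    have d: "Suc (k - Suc 0) = k" "even (k - Suc 0)" using that by auto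
    moreover have "Suc 0 \<le> k" using k by simp
    ultimately show "0 \<le> ?e (U 1 (Suc 0))" "0 \<le> ?e (U 2 (Suc 0))" "0 \<le> ?e (U 3 (Suc 0))"
      "?e (U 1 (Suc 0)) + ?e (U 2 (Suc 0)) + ?e (U 3 (Suc 0)) = 1"
      using snake_start_odd(4)[OF d(2), unfolded d(1), of 1]
        snake_start_odd(4)[OF d(2), unfolded d(1), of 2]
        snake_start_odd(4)[OF d(2), unfolded d(1), of 3]
        snake_start_odd(5)[OF d(2), unfolded d(1)] k that
      by (simp_all del: One_nat_def add: ex in_snake)
  qed
  have last: "?e (U 1 (Suc k)) = 1" "?e (U 2 (Suc k)) = 0" "?e (U 3 (Suc k)) = 0"
    "?e (V 1) = 0" "?e (V 2) = 0" "?e (V 3) = 0" "?e (Z 1) = 1" "?e (Z 2) = 0" "?e (Z 3) = 0"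
    "?e (B 1) = 1" "?e (B 2) = 1"
    using k by (simp_all del: One_nat_def add: ex in_snake local_excess_def on_snake_def)
  have arm: "sum ?e (arm (Suc i)) = 2" if "i < k" for i
    using that
  proof (induction i)
    case 0
    then show ?case
      using first(6) second(4) layer[of 0]
      by (cases "even k") (simp_all del: One_nat_def add: sum_arm_Suc sum_arm_0)
  next
    case (Suc i)
    then show ?case
      using layer[of "Suc i"] by (simp del: One_nat_def add: sum_arm_Suc[of _ "Suc i"])
  qed
  have "sum ?e (pverts (H k)) = 6"
    using arm[of "k - 1"] k last by (simp del: One_nat_def add: sum_H)
  then show "card (snake k) = 2 * k + 11"
    unfolding sum_excess[OF cubic sub] order_H by simp
  have "0 \<le> ?e v" if v: "v \<in> pverts (H k)" for v
  proof (cases v)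
    case (U j i)
    with v consider "i = 0" | "i = Suc 0" "odd k" | i' where "i = Suc i'" "i' < k" "i' \<noteq> 0 \<or> even k" | "i = Suc k"
      by (cases i) (auto simp: le_less)
    then show ?thesis
      using v U first(3-5) second last(1-3) layer(2) by cases auto
  next
    case (M i)
    with v show ?thesis using layer(1)[of "i - 1"] by (cases i) auto
  qed (use v first last in auto)
  then show "dominating12 (H k) (snake k)"
    unfolding dominating12_iff_excess[OF cubic] using sub by simp
qed

lemma gamma12_H: "1 \<le> k \<Longrightarrow> gamma12 (H k) = 2 * k + 11"
  by (rule gamma12_eqI[OF finite_H snake_dominating dominating_H_card])

lemma c_ind_H: "1 \<le> k \<Longrightarrow> c_ind (H k) = 2 * k + 10"
  by (rule c_ind_eqI[OF finite_H long_cycle_induced induced_cycles_H_card])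

section \<open>\<open>H k\<close> is not a trilobite\<close>

definition triangle :: "('a, 'b) pre_digraph \<Rightarrow> 'a \<Rightarrow> 'a \<Rightarrow> 'a \<Rightarrow> bool" where
  "triangle G x y z \<longleftrightarrow> x \<rightarrow>\<^bsub>G\<^esub> y \<and> y \<rightarrow>\<^bsub>G\<^esub> z \<and> x \<rightarrow>\<^bsub>G\<^esub> z"

fun end_adjacent :: "end_type \<Rightarrow> nat \<Rightarrow> tri_vertex \<Rightarrow> tri_vertex \<Rightarrow> bool" where
  "end_adjacent Triangle i (Strand j l) (Strand j' l') \<longleftrightarrow> l = i \<and> l' = i \<and> (j, j') \<in> {(1, 2), (1, 3), (2, 3)}"
| "end_adjacent K23 i (Cap l h) (Strand j l') \<longleftrightarrow> l = i \<and> l' = i \<and> h \<in> {1, 2} \<and> j \<in> {1, 2, 3}"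
| "end_adjacent _ _ _ _ \<longleftrightarrow> False"

fun trilobite_edge :: "nat \<Rightarrow> tri_vertex \<Rightarrow> tri_vertex \<Rightarrow> bool" where
  "trilobite_edge p (Strand j i) (Strand j' i') \<longleftrightarrow> j = j' \<and> i' = i + 1 \<and> j \<in> {1, 2, 3} \<and> 1 \<le> i \<and> i < p"
| "trilobite_edge p (Claw i) (Strand j i') \<longleftrightarrow> i = i' \<and> 1 < i \<and> i < p \<and> j \<in> {1, 2, 3}"
| "trilobite_edge _ _ _ \<longleftrightarrow> False"

lemma end_edges_iff: "(v, w) \<in> end_edges e i \<longleftrightarrow> end_adjacent e i v w"
  by (cases e; cases v; cases w) (auto simp: strand_indices)

lemma trilobite_adjacent_iff:
  "v \<rightarrow>\<^bsub>trilobite_graph p s t\<^esub> w \<longleftrightarrow>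
     (trilobite_edge p v w \<or> end_adjacent s 1 v w \<or> end_adjacent t p v w) \<or>
     (trilobite_edge p w v \<or> end_adjacent s 1 w v \<or> end_adjacent t p w v)"
proof -
  define E where "E = {(Strand j i, Strand j (i + 1)) | j i. j \<in> {1..3} \<and> 1 \<le> i \<and> i < p} \<union>
      {(Claw i, Strand j i) | j i. j \<in> {1..3} \<and> 1 < i \<and> i < p}"
  have E: "(v, w) \<in> E \<longleftrightarrow> trilobite_edge p v w" for v w
    unfolding E_def strand_indices by (cases v; cases w) auto
  have "parcs (trilobite_graph p s t) =
    (E \<union> end_edges s 1 \<union> end_edges t p) \<union> (E \<union> end_edges s 1 \<union> end_edges t p)\<inverse>"
    unfolding trilobite_graph_def undirected_def E_def by simp
  then show ?thesis by (simp add: E end_edges_iff)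
qed

primrec position :: "tri_vertex \<Rightarrow> nat" where
  "position (Strand j i) = i"
| "position (Claw i) = i"
| "position (Cap i h) = i"

context
  fixes p :: nat and s t :: end_type
  assumes p: "2 \<le> p"
begin

abbreviation "triangle_end i \<equiv> i = 1 \<and> s = Triangle \<or> i = p \<and> t = Triangle"

lemma strands_adjacent:
  assumes "Strand j i \<rightarrow>\<^bsub>trilobite_graph p s t\<^esub> Strand j' i'"
  shows "j = j' \<and> (i' = Suc i \<or> i = Suc i') \<or>
    i = i' \<and> j \<noteq> j' \<and> {j, j'} \<subseteq> {1, 2, 3} \<and> triangle_end i"
  using assms unfolding trilobite_adjacent_iff by (cases s; cases t) auto

lemma nonstrand_adjacent:
  assumes "v \<rightarrow>\<^bsub>trilobite_graph p s t\<^esub> w" and "\<And>j i. v \<noteq> Strand j i"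
  shows "\<exists>j. w = Strand j (position v)" and "\<not> triangle_end (position v)"
  using assms p unfolding trilobite_adjacent_iff by (cases s; cases t; cases v; cases w; auto)+

lemma triangle_on_strands:
  assumes "triangle (trilobite_graph p s t) x y z"
  shows "\<exists>j i. x = Strand j i"
proof (rule ccontr)
  assume "\<nexists>j i. x = Strand j i"
  then have x: "\<And>j i. x \<noteq> Strand j i" by blast
  have "x \<rightarrow>\<^bsub>trilobite_graph p s t\<^esub> y" "x \<rightarrow>\<^bsub>trilobite_graph p s t\<^esub> z" "y \<rightarrow>\<^bsub>trilobite_graph p s t\<^esub> z" using assms by (auto simp: triangle_def)
  then obtain j j' where "Strand j (position x) \<rightarrow>\<^bsub>trilobite_graph p s t\<^esub> Strand j' (position x)"
    using nonstrand_adjacent(1) x by metis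
  then show False
    using strands_adjacent nonstrand_adjacent(2)[OF \<open>x \<rightarrow>\<^bsub>trilobite_graph p s t\<^esub> y\<close> x] by fastforce
qed

text \<open>
  Claw centres and the centres of a \<open>K\<^sub>2\<^sub>,\<^sub>3\<close> lie in no triangle, because their
  neighbours are pairwise nonadjacent. Three strand vertices that are pairwise adjacent
  have the same position. Naming one particular vertex of the triangle makes two
  disjoint triangles occupy different ends.
\<close>

lemma trilobite_triangle:
  assumes "triangle (trilobite_graph p s t) x y z"
  shows "s = Triangle \<and> Strand 1 1 \<in> {x, y, z} \<or> t = Triangle \<and> Strand 1 p \<in> {x, y, z}"
proof -
  have "triangle (trilobite_graph p s t) y x z" "triangle (trilobite_graph p s t) z x y"
    using assms unfolding triangle_def trilobite_adjacent_iff by blast+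
  then obtain j i j' i' j'' i'' where
    xyz: "x = Strand j i" "y = Strand j' i'" "z = Strand j'' i''"
    using assms triangle_on_strands by metis
  have "Strand j i \<rightarrow>\<^bsub>trilobite_graph p s t\<^esub> Strand j' i'" "Strand j' i' \<rightarrow>\<^bsub>trilobite_graph p s t\<^esub> Strand j'' i''" "Strand j i \<rightarrow>\<^bsub>trilobite_graph p s t\<^esub> Strand j'' i''"
    using assms by (simp_all add: triangle_def xyz)
  note this[THEN strands_adjacent]
  then have "i' = i" "i'' = i" "{j, j', j''} \<subseteq> {1, 2, 3}" "j \<noteq> j'" "j' \<noteq> j''" "j \<noteq> j''" "triangle_end i"
    by auto
  then show ?thesis unfolding xyz by auto
qed

end

lemma triangle_app_iso:
  assumes "wf_digraph G" "pre_digraph.digraph_isomorphism G g" "triangle G x y z"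
  shows "triangle (app_iso g G) (iso_verts g x) (iso_verts g y) (iso_verts g z)"
  using assms unfolding triangle_def
  by (auto simp: wf_digraph.arcs_ends_app_iso_eq)

lemma order_trilobite_graph_Triangle:
  assumes "2 \<le> p"
  shows "order (trilobite_graph p Triangle Triangle) + 2 = 4 * p"
proof -
  have "pverts (trilobite_graph p Triangle Triangle)
      = (\<Union>j\<in>{1, 2, 3}. Strand j ` {1..p}) \<union> Claw ` {2..<p}"
    unfolding trilobite_graph_def undirected_def strand_indices by auto
  moreover have "card \<dots> = card (\<Union>j\<in>{1, 2, 3 :: nat}. Strand j ` {1..p}) + card (Claw ` {2..<p})"
    by (rule card_Un_disjoint) auto
  moreover have "card (\<Union>j\<in>{1, 2, 3 :: nat}. Strand j ` {1..p}) = 3 * p"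
    by (subst card_UN_disjoint) (auto simp: card_image inj_on_def)
  moreover have "card (Claw ` {2..<p}) = p - 2"
    by (simp add: card_image inj_on_def)
  ultimately show ?thesis using assms by simp
qed

text \<open>
  The two triangles of \<open>H k\<close> are disjoint. A trilobite with two disjoint triangles has
  triangles at both ends and hence order \<open>4 p - 2\<close>, whereas the order of \<open>H k\<close> is
  divisible by 4.
\<close>

lemma H_not_trilobite:
  assumes k: "1 \<le> k"
  shows "\<not> trilobite (H k)"
proof
  assume "trilobite (H k)"
  then obtain p s t where p: "2 \<le> p" and iso: "digraph_iso (trilobite_graph p s t) (H k)"
    by (auto simp: trilobite_def)
  then have wf: "wf_digraph (trilobite_graph p s t)"
    by (auto simp: digraph_iso_def pre_digraph.digraph_isomorphism_def)
  then obtain g where g: "pre_digraph.digraph_isomorphism (H k) g"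
    and T: "with_proj (trilobite_graph p s t) = app_iso g (with_proj (H k))"
    using digraph_iso_swap[OF wf iso] by (auto simp: digraph_iso_def)
  have wfH: "wf_digraph (H k)" using g by (simp add: pre_digraph.digraph_isomorphism_def)
  have inj: "inj_on (iso_verts g) (pverts (H k))"
    using g by (simp add: pre_digraph.digraph_isomorphism_def)
  have "triangle (H k) (U 1 (k + 1)) (U 2 (k + 1)) (V 1)"
    and "triangle (H k) (U 3 (k + 1)) (V 2) (V 3)"
    by (simp_all add: triangle_def H_arcs)
  note this[THEN triangle_app_iso[OF wfH g], folded T, THEN trilobite_triangle[OF p]]
  moreover have "iso_verts g x \<noteq> iso_verts g y"
    if "x \<in> {U 1 (k + 1), U 2 (k + 1), V 1}" "y \<in> {U 3 (k + 1), V 2, V 3}" for x y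
    using that inj by (auto dest!: inj_onD)
  ultimately have "s = Triangle" "t = Triangle" by (smt (verit) insertE insertI1 insertI2 emptyE)+
  then have "order (trilobite_graph p s t) + 2 = 4 * p"
    using order_trilobite_graph_Triangle[OF p] by simp
  moreover have "pverts (trilobite_graph p s t) = iso_verts g ` pverts (H k)"
    using arg_cong[OF T, of verts] by simp
  then have "order (trilobite_graph p s t) = 4 * k + 16"
    by (simp add: card_image[OF inj] order_H)
  ultimately show False by presburger
qed

section \<open>Graphs on the natural numbers\<close>

definition relabel :: "('a \<Rightarrow> 'b) \<Rightarrow> 'a pair_pre_digraph \<Rightarrow> 'b pair_pre_digraph" where
  "relabel f G = \<lparr> pverts = f ` pverts G, parcs = map_prod f f ` parcs G \<rparr>"

locale relabelling =
  fixes G :: "'a pair_pre_digraph" and f :: "'a \<Rightarrow> 'b"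
  assumes cubic: "cubic_graph G" and inj: "inj_on f (pverts G)"
begin

lemma isomorphism:
  obtains g where "pre_digraph.digraph_isomorphism (with_proj G) g"
    and "with_proj (relabel f G) = app_iso g (with_proj G)"
proof
  interpret pair_graph G using cubic by (simp add: cubic_graph_def)
  let ?g = "\<lparr> iso_verts = f, iso_arcs = map_prod f f, iso_head = snd, iso_tail = fst \<rparr>"
  have "parcs G \<subseteq> pverts G \<times> pverts G" by (auto dest: in_arcsD1 in_arcsD2)
  then have "inj_on (map_prod f f) (parcs G)"
    using inj map_prod_inj_on inj_on_subset by blast
  then show "pre_digraph.digraph_isomorphism (with_proj G) ?g"
    using inj wf_digraph_axioms by (auto simp: digraph_isomorphism_def)
  show "with_proj (relabel f G) = app_iso ?g (with_proj G)"
    by (simp add: with_proj_def relabel_def app_iso_def)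
qed

lemma adjacent_iff:
  assumes "u \<in> pverts G" "v \<in> pverts G"
  shows "f u \<rightarrow>\<^bsub>relabel f G\<^esub> f v \<longleftrightarrow> u \<rightarrow>\<^bsub>G\<^esub> v"
proof
  interpret pair_graph G using cubic by (simp add: cubic_graph_def)
  assume "f u \<rightarrow>\<^bsub>relabel f G\<^esub> f v"
  then obtain u' v' where "(u', v') \<in> parcs G" "f u' = f u" "f v' = f v"
    by (auto simp: relabel_def)
  then show "u \<rightarrow>\<^bsub>G\<^esub> v"
    using assms inj by (auto dest: in_arcsD1 in_arcsD2 inj_onD)
next
  assume "u \<rightarrow>\<^bsub>G\<^esub> v"
  then show "f u \<rightarrow>\<^bsub>relabel f G\<^esub> f v" by (force simp: relabel_def)
qed

lemma pverts_relabel: "pverts (relabel f G) = f ` pverts G"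
  by (simp add: relabel_def)

lemma order_relabel: "order (relabel f G) = order G"
  by (simp add: pverts_relabel card_image inj)

lemma cubic_relabel: "cubic_graph (relabel f G)"
proof -
  interpret pair_graph G using cubic by (simp add: cubic_graph_def)
  obtain g where g: "digraph_isomorphism g" "with_proj (relabel f G) = app_iso g (with_proj G)" using isomorphism .
  have "pair_graph (relabel f G)"
  proof
    fix e assume "e \<in> parcs (relabel f G)"
    then obtain u v where uv: "(u, v) \<in> parcs G" "e = (f u, f v)" by (auto simp: relabel_def)
    then have "u \<in> pverts G" "v \<in> pverts G" "u \<noteq> v"
      by (auto dest: in_arcsD1 in_arcsD2 no_loops')
    then show "fst e \<in> pverts (relabel f G)" "snd e \<in> pverts (relabel f G)" "fst e \<noteq> snd e"
      using uv inj by (auto simp: relabel_def dest: inj_onD)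
  next
    show "finite (pverts (relabel f G))" "finite (parcs (relabel f G))"
      by (simp_all add: relabel_def)
    show "symmetric (relabel f G)"
      by (force simp: relabel_def symmetric_def intro!: symI dest: arcs_symmetric)
  qed
  moreover have "regular 3 (relabel f G)"
    unfolding regular_def g(2)
  proof
    fix w assume "w \<in> verts (app_iso g (with_proj G))"
    then obtain v where v: "v \<in> pverts G" "w = iso_verts g v" by auto
    then have "out_degree (app_iso g (with_proj G)) w = out_degree G v"
      using out_degree_app_iso_eq[OF g(1)] by simp
    then show "out_degree (app_iso g (with_proj G)) w = 3"
      using cubic v(1) by (simp add: cubic_graph_def regular_def)
  qed
  ultimately show ?thesis by (simp add: cubic_graph_def)
qed

lemma connected_relabel: "connected G \<Longrightarrow> connected (relabel f G)"
proof -
  interpret pair_graph G using cubic by (simp add: cubic_graph_def)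
  assume "connected G"
  then show ?thesis using isomorphism connectedI_app_iso by metis
qed

lemma excess_relabel:
  assumes "S \<subseteq> pverts G" "v \<in> pverts G"
  shows "excess (relabel f G) (f ` S) (f v) = excess G S v"
proof -
  have "{u \<in> f ` S. f v \<rightarrow>\<^bsub>relabel f G\<^esub> u} = f ` {u \<in> S. v \<rightarrow>\<^bsub>G\<^esub> u}"
    using adjacent_iff assms by auto
  moreover have "inj_on f {u \<in> S. v \<rightarrow>\<^bsub>G\<^esub> u}"
    using inj assms(1) by (auto intro: inj_on_subset)
  moreover have "f v \<in> f ` S \<longleftrightarrow> v \<in> S"
    using inj assms by (auto dest: inj_onD)
  ultimately show ?thesis by (simp add: excess_def card_image)
qed

lemma image_card_sets:
  assumes "\<And>S. S \<subseteq> pverts G \<Longrightarrow> Q (f ` S) \<longleftrightarrow> P S"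
  shows "{card T | T. T \<subseteq> pverts (relabel f G) \<and> Q T} = {card S | S. S \<subseteq> pverts G \<and> P S}"
proof -
  have "card (f ` S) = card S" if "S \<subseteq> pverts G" for S
    using inj that by (intro card_image) (rule inj_on_subset)
  moreover have "{T. T \<subseteq> pverts (relabel f G) \<and> Q T} = (`) f ` {S. S \<subseteq> pverts G \<and> P S}"
  proof (intro set_eqI iffI)
    fix T assume "T \<in> {T. T \<subseteq> pverts (relabel f G) \<and> Q T}"
    then obtain S where "S \<subseteq> pverts G" "T = f ` S" "Q (f ` S)"
      by (auto simp: pverts_relabel subset_image_iff)
    then show "T \<in> (`) f ` {S. S \<subseteq> pverts G \<and> P S}" using assms by auto
  next
    fix T assume "T \<in> (`) f ` {S. S \<subseteq> pverts G \<and> P S}"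
    then obtain S where "S \<subseteq> pverts G" "T = f ` S" "P S" by auto
    then show "T \<in> {T. T \<subseteq> pverts (relabel f G) \<and> Q T}"
      using assms by (simp add: pverts_relabel image_mono)
  qed
  ultimately show ?thesis
    by (simp add: setcompr_eq_image image_image cong: image_cong_simp)
qed

lemma gamma12_relabel: "gamma12 (relabel f G) = gamma12 G"
proof -
  have "{card T | T. T \<subseteq> pverts (relabel f G) \<and> dominating12 (relabel f G) T}
      = {card S | S. S \<subseteq> pverts G \<and> dominating12 G S}"
    by (rule image_card_sets)
       (auto simp: dominating12_iff_excess cubic cubic_relabel pverts_relabel excess_relabel)
  then show ?thesis unfolding gamma12_def by (simp add: dominating12_def)
qed

lemma c_ind_relabel: "c_ind (relabel f G) = c_ind G"
  unfolding c_ind_def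
  by (subst image_card_sets) (auto simp: regular2_induced_iff_excess excess_relabel subset_iff)

lemma trilobite_relabel: "trilobite (relabel f G) \<Longrightarrow> trilobite G"
proof -
  interpret pair_graph G using cubic by (simp add: cubic_graph_def)
  assume "trilobite (relabel f G)"
  then obtain p s t where p: "p \<ge> 2" "digraph_iso (trilobite_graph p s t) (relabel f G)"
    and "order G \<ge> 10" by (auto simp: trilobite_def order_relabel)
  have "digraph_iso G (relabel f G)"
    using isomorphism by (metis digraph_iso_def)
  then have "digraph_iso (relabel f G) G" by (rule digraph_iso_swap[rotated]) unfold_locales
  then have "digraph_iso (trilobite_graph p s t) G" using p(2) digraph_iso_trans by blast
  then show ?thesis using cubic p(1) \<open>order G \<ge> 10\<close> by (auto simp: trilobite_def)
qed

end

lemma cubic_graph_on_nat: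
  fixes G :: "'a pair_pre_digraph"
  assumes "cubic_graph G"
  obtains G' :: "nat pair_pre_digraph"
  where "cubic_graph G'" "order G' = order G" "gamma12 G' = gamma12 G" "c_ind G' = c_ind G"
    "connected G \<Longrightarrow> connected G'" "trilobite G' \<Longrightarrow> trilobite G"
proof -
  obtain f :: "'a \<Rightarrow> nat" where "inj_on f (pverts G)"
    using finite_imp_inj_to_nat_seg[OF cubic_graphD(1)[OF assms]] by blast
  with assms interpret relabelling G f by unfold_locales
  show thesis
    by (rule that[of "relabel f G"])
       (simp_all add: cubic_relabel order_relabel gamma12_relabel c_ind_relabel
          connected_relabel trilobite_relabel)
qed

section \<open>The conjectures fail\<close>

lemma violating_graph:
  assumes k: "1 \<le> k"
  obtains G :: "nat pair_pre_digraph"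
  where "order G = 4 * k + 16" "\<not> conjecture_I_for G" "\<not> conjecture_II_for G"
proof -
  obtain G :: "nat pair_pre_digraph" where G: "cubic_graph G" "order G = order (H k)"
    "gamma12 G = gamma12 (H k)" "c_ind G = c_ind (H k)"
    "connected (H k) \<Longrightarrow> connected G" "trilobite G \<Longrightarrow> trilobite (H k)"
    using cubic_graph_on_nat[OF cubic_H[OF k]] by metis
  show thesis
  proof (rule that[of G])
    show "order G = 4 * k + 16" using G(2) order_H by simp
    show "\<not> conjecture_I_for G" "\<not> conjecture_II_for G"
      using G connected_H[OF k] H_not_trilobite[OF k]
      by (auto simp: conjecture_I_for_def conjecture_II_for_def gamma12_H[OF k] c_ind_H[OF k] order_H)
  qed
qed

lemma infinite_orders:
  assumes "\<And>k. 1 \<le> k \<Longrightarrow> P (4 * k + 16)"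
  shows "infinite {n :: nat. n \<ge> 20 \<and> n mod 4 = 0 \<and> P n}"
proof -
  have "infinite ((\<lambda>k. 4 * k + 16 :: nat) ` {1..})"
    by (subst finite_image_iff) (auto simp: inj_on_def infinite_Ici)
  moreover have "(\<lambda>k. 4 * k + 16) ` {1..} \<subseteq> {n. n \<ge> 20 \<and> n mod 4 = 0 \<and> P n}"
  proof clarify
    fix k :: nat assume "1 \<le> k"
    moreover have "(4 * k + 16) mod 4 = 0" by presburger
    ultimately show "4 * k + 16 \<ge> 20 \<and> (4 * k + 16) mod 4 = 0 \<and> P (4 * k + 16)"
      using assms by simp
  qed
  ultimately show ?thesis using finite_subset by blast
qed

theorem corollary17:
  shows "(\<forall>k\<ge>1.
            cubic_graph (H k) \<and> connected (H k) \<and>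
            gamma12 (H k) > c_ind (H k) \<and> \<not> trilobite (H k) \<and>
            order (H k) = 4 * k + 16 \<and>
            real (c_ind (H k)) = real (order (H k)) / 2 + 2 \<and>
            real (gamma12 (H k)) = real (order (H k)) / 2 + 3) \<and>
         \<not> conjecture_I \<and>
         \<not> conjecture_II \<and>
         infinite {n. n \<ge> 20 \<and> n mod 4 = 0 \<and>
           (\<exists>G :: nat pair_pre_digraph. order G = n \<and> \<not> conjecture_I_for G)} \<and>
         infinite {n. n \<ge> 20 \<and> n mod 4 = 0 \<and>
           (\<exists>G :: nat pair_pre_digraph. order G = n \<and> \<not> conjecture_II_for G)}"
proof (intro conjI allI impI)
  fix k :: nat assume k: "1 \<le> k"
  show "cubic_graph (H k)" "connected (H k)" "\<not> trilobite (H k)" "order (H k) = 4 * k + 16"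
    using cubic_H connected_H H_not_trilobite order_H k by blast+
  show "gamma12 (H k) > c_ind (H k)" "real (c_ind (H k)) = real (order (H k)) / 2 + 2"
    "real (gamma12 (H k)) = real (order (H k)) / 2 + 3"
    by (simp_all add: gamma12_H[OF k] c_ind_H[OF k] order_H)
next
  show "\<not> conjecture_I" "\<not> conjecture_II"
    using violating_graph[of 1] by (auto simp: conjecture_I_def conjecture_II_def)
  show "infinite {n. n \<ge> 20 \<and> n mod 4 = 0 \<and>
      (\<exists>G :: nat pair_pre_digraph. order G = n \<and> \<not> conjecture_I_for G)}"
    by (rule infinite_orders) (metis violating_graph)
  show "infinite {n. n \<ge> 20 \<and> n mod 4 = 0 \<and>
      (\<exists>G :: nat pair_pre_digraph. order G = n \<and> \<not> conjecture_II_for G)}"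
    by (rule infinite_orders) (metis violating_graph)
qed

end
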